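(* Let $m \ge n \ge 1$ be integers and let $x=(x_1,\dots,x_n) \in \mathbb{R}^n$ be a probability distribution (nonnegative entries summing to $1$) whose smallest positive entry is at least $1/m$. Let $0<\epsilon<1$. Define $$\mu = \frac{\epsilon}{4\log m},\qquad \nu = \frac{\epsilon}{4\,\log n\,\log m},\qquad \alpha = 1+\frac{\mu}{16\log(1/\mu)},\qquad \beta = 1+\frac{\nu}{16\log(1/\nu)}.$$ Then $$1 \le \frac{H_1}{H_\alpha} \le 1+\epsilon \qquad\text{and}\qquad 0 \le H_1 - H_\beta \le \epsilon .$$
   Context: Logarithms are natural. For $\gamma>0$, $\gamma\neq 1$, the Rényi entropy of $x$ is $H_\gamma = \frac{1}{1-\gamma}\ln\big(\sum_{i=1}^n x_i^\gamma\big)$, and $H_1 = -\sum_{i=1}^n x_i \ln x_i$ is the Shannon entropy (with $0\ln 0 = 0$). *)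

theory Defs
  imports "HOL-Analysis.Analysis"
begin

definition prob_vector :: "real ^ 'n \<Rightarrow> bool" where
  "prob_vector x \<longleftrightarrow> (\<forall>i. 0 \<le> x $ i) \<and> (\<Sum>i\<in>UNIV. x $ i) = 1"

(* Zero entries contribute 0 in both formulas: 0 * ln 0 = 0, and 0 powr \<gamma> = 0
   (only \<gamma> > 0 is meant). *)
definition renyi_entropy :: "real \<Rightarrow> real ^ 'n \<Rightarrow> real" where
  "renyi_entropy \<gamma> x =
     (if \<gamma> = 1 then - (\<Sum>i\<in>UNIV. x $ i * ln (x $ i))
      else 1 / (1 - \<gamma>) * ln (\<Sum>i\<in>UNIV. (x $ i) powr \<gamma>))"

end

theory Submission
  imports Defs
begin

text \<open>
  Under \<open>x\<close> itself as the distribution, the random variable \<open>L = - ln x\<^sub>i\<close> takes values in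
  \<open>[0, ln m]\<close>, has mean \<open>H\<^sub>1\<close>, and \<open>H\<^sub>1\<^sub>+\<^sub>a = - ln (E exp (- a L)) / a\<close>. Jensen's inequality
  gives \<open>H\<^sub>1\<^sub>+\<^sub>a \<le> H\<^sub>1\<close>. Conversely \<open>exp (- u) \<le> 1 - u + u\<^sup>2 / 2\<close> for \<open>u \<ge> 0\<close>, and
  \<open>E L\<^sup>2 \<le> ln m * H\<^sub>1\<close>, so \<open>H\<^sub>1 - H\<^sub>1\<^sub>+\<^sub>a \<le> a * ln m * H\<^sub>1 / 2\<close>. This is the multiplicative
  bound, and with \<open>H\<^sub>1 \<le> ln n\<close> also the additive one.
\<close>

text \<open>The product of \<open>1 - u + u\<^sup>2 / 2\<close> and
  \<open>1 + u + u\<^sup>2 / 2\<close> is \<open>1 + u ^ 4 / 4\<close>, hence at least 1, and the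
  second factor is at most \<open>exp u\<close>.\<close>

lemma exp_minus_le_quadratic:
  fixes u :: real
  assumes "0 \<le> u"
  shows "exp (- u) \<le> 1 - u + u\<^sup>2 / 2"
proof -
  \<comment> \<open>The quadratic equals \<open>((u - 1)\<^sup>2 + 1) / 2\<close>.\<close>
  have pos: "0 < 1 - u + u\<^sup>2 / 2"
    using zero_le_power2[of "u - 1"] by (simp add: power2_diff)
  have "1 \<le> 1 + u ^ 4 / 4" by simp
  also have "\<dots> = (1 - u + u\<^sup>2 / 2) * (1 + u + u\<^sup>2 / 2)"
    by (simp add: field_simps power2_eq_square power4_eq_xxxx)
  also have "\<dots> \<le> (1 - u + u\<^sup>2 / 2) * exp u"
    using pos exp_lower_Taylor_quadratic[OF assms] by (intro mult_left_mono) auto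
  finally show ?thesis by (simp add: exp_minus divide_simps)
qed

lemma prob_vector_le_1:
  assumes "prob_vector x"
  shows "x $ i \<le> 1"
proof -
  have "x $ i \<le> (\<Sum>i\<in>UNIV. x $ i)"
    using assms by (intro member_le_sum) (auto simp: prob_vector_def)
  then show ?thesis using assms by (simp add: prob_vector_def)
qed

lemma renyi_entropy_1: "renyi_entropy 1 x = (\<Sum>i\<in>UNIV. - (x $ i * ln (x $ i)))"
  by (simp add: renyi_entropy_def sum_negf)

lemma renyi_entropy_1_nonneg:
  assumes "prob_vector x"
  shows "0 \<le> renyi_entropy 1 x"
  unfolding renyi_entropy_1
proof (rule sum_nonneg)
  fix i
  have "0 \<le> x $ i" using assms by (simp add: prob_vector_def)
  moreover have "ln (x $ i) \<le> 0" using \<open>0 \<le> x $ i\<close> prob_vector_le_1[OF assms, of i]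
    by (cases "x $ i = 0") auto
  ultimately show "0 \<le> - (x $ i * ln (x $ i))" by (simp add: mult_nonneg_nonpos)
qed

text \<open>Gibbs' inequality against the uniform distribution: \<open>ln t \<le> t - 1\<close> at
  \<open>t = 1 / (p * ?n)\<close>, weighted by \<open>p\<close>. The corrections
  \<open>1 / ?n - p\<close> cancel on summation.\<close>

lemma renyi_entropy_1_le_ln_card:
  fixes x :: "real ^ 'n"
  assumes "prob_vector x"
  shows "renyi_entropy 1 x \<le> ln (real CARD('n))"
proof -
  let ?n = "real CARD('n)"
  have n: "0 < ?n" by simp
  have "- (p * ln p) \<le> p * ln ?n + 1 / ?n - p" if "0 \<le> p" for p
  proof (cases "p = 0")
    case False
    then have p: "0 < p" using that by simp
    have "ln (1 / (p * ?n)) \<le> 1 / (p * ?n) - 1"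
      using p n by (intro ln_le_minus_one) (simp add: field_simps)
    then have "p * ln (1 / (p * ?n)) \<le> p * (1 / (p * ?n) - 1)"
      using p by (intro mult_left_mono) auto
    moreover have "p * (1 / (p * ?n) - 1) = 1 / ?n - p" using p by (simp add: field_simps)
    moreover have "ln (1 / (p * ?n)) = - ln p - ln ?n" using p by (simp add: ln_div ln_mult)
    ultimately show ?thesis by (simp add: algebra_simps)
  qed simp
  then have "renyi_entropy 1 x \<le> (\<Sum>i\<in>UNIV. x $ i * ln ?n + 1 / ?n - x $ i)"
    unfolding renyi_entropy_1 using assms by (intro sum_mono) (simp add: prob_vector_def)
  also have "\<dots> = ln ?n"
    using assms by (simp add: sum.distrib sum_subtractf prob_vector_def flip: sum_distrib_right)
  finally show ?thesis .
qed

text \<open>Jensen's inequality for \<open>exp\<close>, proved termwise with the tangent line at the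
  mean exponent \<open>- a * H\<close>. The linear deviations average to zero under
  \<open>x\<close>.\<close>

lemma exp_minus_entropy_le_sum_powr:
  assumes "prob_vector x"
  shows "exp (- a * renyi_entropy 1 x) \<le> (\<Sum>i\<in>UNIV. x $ i powr (1 + a))"
proof -
  define H where "H = renyi_entropy 1 x"
  have "exp (- a * H) * (p + a * (p * ln p) + a * H * p) \<le> p powr (1 + a)" if "0 \<le> p" for p
  proof (cases "p = 0")
    case False
    then have p: "0 < p" using that by simp
    have "exp (- a * H) * (p * (1 + (a * ln p + a * H))) \<le> exp (- a * H) * (p * exp (a * ln p + a * H))"
      using p by (intro mult_left_mono exp_ge_add_one_self) auto
    also have "\<dots> = p powr (1 + a)"
      using p by (simp add: powr_def exp_add exp_minus field_simps)
    finally show ?thesis by (simp add: algebra_simps)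
  qed simp
  then have "(\<Sum>i\<in>UNIV. exp (- a * H) * (x $ i + a * (x $ i * ln (x $ i)) + a * H * x $ i))
      \<le> (\<Sum>i\<in>UNIV. x $ i powr (1 + a))"
    using assms by (intro sum_mono) (simp add: prob_vector_def)
  moreover have "(\<Sum>i\<in>UNIV. x $ i * ln (x $ i)) = - H"
    by (simp add: H_def renyi_entropy_def)
  ultimately show ?thesis
    using assms by (simp add: sum.distrib prob_vector_def H_def flip: sum_distrib_left)
qed

text \<open>The quadratic bound on \<open>exp (- (a * L))\<close> is made linear in \<open>L\<close>
  by \<open>L * L \<le> M * L\<close>, so that summation only produces multiples of the Shannon
  entropy.\<close>

lemma sum_powr_le:
  assumes "prob_vector x" and "0 \<le> a" and M: "\<And>i. 0 < x $ i \<Longrightarrow> - ln (x $ i) \<le> M"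
  shows "(\<Sum>i\<in>UNIV. x $ i powr (1 + a))
    \<le> 1 - a * renyi_entropy 1 x + a\<^sup>2 * M / 2 * renyi_entropy 1 x"
proof -
  define H where "H = renyi_entropy 1 x"
  have "x $ i powr (1 + a)
      \<le> x $ i + a * (x $ i * ln (x $ i)) - a\<^sup>2 * M / 2 * (x $ i * ln (x $ i))" for i
  proof (cases "x $ i = 0")
    case False
    define p where "p = x $ i"
    have p: "0 < p" "p \<le> 1" using False assms(1) prob_vector_le_1[OF assms(1), of i]
      by (auto simp: p_def prob_vector_def less_le)
    define L where "L = - ln p"
    have L: "0 \<le> L" "L \<le> M" using p M[of i] by (auto simp: L_def p_def)
    have "p powr (1 + a) = p * exp (- (a * L))"
      using p by (simp add: powr_def exp_add L_def algebra_simps)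
    also have "\<dots> \<le> p * (1 - a * L + (a * L)\<^sup>2 / 2)"
      using p L assms(2) by (intro mult_left_mono exp_minus_le_quadratic) auto
    also have "\<dots> \<le> p * (1 - a * L + a\<^sup>2 * (M * L) / 2)"
      using p L mult_right_mono[OF L(2,1)]
      by (intro mult_left_mono add_left_mono divide_right_mono)
         (auto simp: power_mult_distrib power2_eq_square[of L] intro!: mult_left_mono)
    finally show ?thesis by (simp add: p_def L_def algebra_simps)
  qed simp
  then have "(\<Sum>i\<in>UNIV. x $ i powr (1 + a)) \<le> (\<Sum>i\<in>UNIV. x $ i + a * (x $ i * ln (x $ i))
      - a\<^sup>2 * M / 2 * (x $ i * ln (x $ i)))"
    by (intro sum_mono)
  moreover have "(\<Sum>i\<in>UNIV. x $ i * ln (x $ i)) = - H"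
    by (simp add: H_def renyi_entropy_def)
  ultimately show ?thesis
    using assms(1)
    by (simp only: sum.distrib sum_subtractf prob_vector_def H_def flip: sum_distrib_left)
qed

lemma renyi_entropy_bounds:
  assumes "prob_vector x" and "0 \<le> a" and M: "\<And>i. 0 < x $ i \<Longrightarrow> - ln (x $ i) \<le> M"
  shows "renyi_entropy (1 + a) x \<le> renyi_entropy 1 x" (is ?upper)
    and "(1 - a * M / 2) * renyi_entropy 1 x \<le> renyi_entropy (1 + a) x" (is ?lower)
proof -
  define H where "H = renyi_entropy 1 x"
  define S where "S = (\<Sum>i\<in>UNIV. x $ i powr (1 + a))"
  have "?upper \<and> ?lower"
  \<comment> \<open>At order 1 the definition switches to the Shannon formula, and dividing by
    \<open>a\<close> is impossible.\<close>
  proof (cases "a = 0")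
    case True
    then show ?thesis by simp
  next
    case False
    then have a: "0 < a" using assms(2) by simp
    have lo: "exp (- a * H) \<le> S"
      using exp_minus_entropy_le_sum_powr[OF assms(1)] by (simp add: H_def S_def)
    then have S: "0 < S" using exp_gt_zero[of "- a * H"] by linarith
    have "- a * H \<le> ln S" using lo S by (simp add: ln_ge_iff)
    moreover have "ln S \<le> - a * H + a\<^sup>2 * M / 2 * H"
      using sum_powr_le[OF assms] ln_le_minus_one[OF S] by (simp add: H_def S_def)
    moreover have "a * renyi_entropy (1 + a) x = - ln S"
      using a by (simp add: renyi_entropy_def S_def)
    ultimately have "a * renyi_entropy (1 + a) x \<le> a * H"
      "a * ((1 - a * M / 2) * H) \<le> a * renyi_entropy (1 + a) x"
      by (auto simp: algebra_simps power2_eq_square)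
    then show ?thesis using a by (simp add: H_def)
  qed
  then show ?upper ?lower by auto
qed

text \<open>For \<open>t \<le> 9 / 16\<close>, \<open>ln t \<le> t - 1\<close> gives
  \<open>ln (1 / t) \<ge> 7 / 16\<close>. The threshold is \<open>1 / (4 * (2 / 3)\<^sup>2)\<close>,
  the bound on \<open>\<nu>\<close> that follows from \<open>ln 2 \<ge> 2 / 3\<close>.\<close>

lemma divide_ln_inverse_bounds:
  fixes t :: real
  assumes "0 < t" and "t \<le> 9 / 16"
  shows "0 \<le> t / (16 * ln (1 / t))" and "t / (16 * ln (1 / t)) \<le> t / 7"
proof -
  have "ln t \<le> t - 1" using assms by (intro ln_le_minus_one) auto
  then have "7 / 16 \<le> ln (1 / t)" using assms by (simp add: ln_div)
  then have "7 \<le> 16 * ln (1 / t)" by simp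
  then show "0 \<le> t / (16 * ln (1 / t))"
    using assms by (intro divide_nonneg_nonneg) linarith+
  show "t / (16 * ln (1 / t)) \<le> t / 7"
    using \<open>7 \<le> 16 * ln (1 / t)\<close> assms by (intro frac_le) linarith+
qed

theorem mainTheorem1:
  fixes x :: "real ^ 'n" and m n :: nat and \<epsilon> \<mu> \<nu> \<alpha> \<beta> :: real
  assumes "n = CARD('n)" and "1 \<le> n" and "n \<le> m"
    and "prob_vector x"
    and "1 / real m \<le> Min {x $ i |i. 0 < x $ i}"
    and "0 < \<epsilon>" and "\<epsilon> < 1"
    and "\<mu> = \<epsilon> / (4 * ln (real m))"
    and "\<nu> = \<epsilon> / (4 * ln (real n) * ln (real m))"
    and "\<alpha> = 1 + \<mu> / (16 * ln (1 / \<mu>))"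
    and "\<beta> = 1 + \<nu> / (16 * ln (1 / \<nu>))"
  shows "(\<not> (renyi_entropy 1 x = 0 \<and> renyi_entropy \<alpha> x = 0) \<longrightarrow>
            1 \<le> renyi_entropy 1 x / renyi_entropy \<alpha> x \<and>
            renyi_entropy 1 x / renyi_entropy \<alpha> x \<le> 1 + \<epsilon>) \<and>
         0 \<le> renyi_entropy 1 x - renyi_entropy \<beta> x \<and>
         renyi_entropy 1 x - renyi_entropy \<beta> x \<le> \<epsilon>"
proof -
  have M: "- ln (x $ i) \<le> ln (real m)" if "0 < x $ i" for i
  proof -
    have "Min {x $ i |i. 0 < x $ i} \<le> x $ i" using that by (intro Min_le) auto
    then have "1 / real m \<le> x $ i" using assms(5) by linarith
    then have "ln (1 / real m) \<le> ln (x $ i)" using assms(2,3) that by (subst ln_le_cancel_iff) auto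
    then show ?thesis using assms(2,3) by (simp add: ln_div)
  qed
  have ln_ge: "2 / 3 \<le> ln (real k)" if "2 \<le> k" for k :: nat
  proof -
    have "ln 2 \<le> ln (real k)" using that by (subst ln_le_cancel_iff) auto
    then show ?thesis using ln2_ge_two_thirds by linarith
  qed
  define a b where "a = \<mu> / (16 * ln (1 / \<mu>))" and "b = \<nu> / (16 * ln (1 / \<nu>))"
  let ?H = "renyi_entropy 1 x"
  have H: "0 \<le> ?H" "?H \<le> ln (real n)"
    using renyi_entropy_1_nonneg renyi_entropy_1_le_ln_card \<open>prob_vector x\<close> assms(1) by auto
  \<comment> \<open>For \<open>m = 1\<close> (resp. \<open>n = 1\<close>) division by zero makes \<open>\<mu>\<close> (resp. \<open>\<nu>\<close>) zero, so the order is 1.\<close>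
  have a: "0 \<le> a \<and> a * ln (real m) \<le> \<epsilon> / 28"
  proof (cases "m = 1")
    case False
    then have l: "2 / 3 \<le> ln (real m)" using ln_ge[of m] assms(2,3) by auto
    then have "\<mu> \<le> 1 / (4 * (2 / 3))"
      unfolding assms(8) using assms(6,7) by (intro frac_le) auto
    moreover have "0 < \<mu>" using l assms(6,8) by simp
    ultimately have *: "0 \<le> a" "a \<le> \<mu> / 7"
      using divide_ln_inverse_bounds[of \<mu>] by (auto simp: a_def)
    \<comment> \<open>Since \<open>\<mu> * ln (real m) = \<epsilon> / 4\<close>, the right side is
      \<open>\<epsilon> / 28\<close>.\<close>
    have "a * ln (real m) \<le> \<mu> / 7 * ln (real m)" using * l by (intro mult_right_mono) auto
    then show ?thesis using * l by (simp add: assms(8))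
  qed (use assms(6,8) in \<open>simp add: a_def\<close>)
  have b: "0 \<le> b \<and> b * ln (real m) * ln (real n) \<le> \<epsilon> / 28"
  proof (cases "n = 1")
    case False
    then have l: "2 / 3 \<le> ln (real n)" "2 / 3 \<le> ln (real m)" using ln_ge assms(2,3) by auto
    then have ll: "2 / 3 * (2 / 3) \<le> ln (real n) * ln (real m)" by (intro mult_mono) auto
    then have "\<nu> \<le> 1 / (4 * (2 / 3 * (2 / 3)))"
      unfolding assms(9) mult.assoc using assms(6,7) by (intro frac_le) linarith+
    moreover have "0 < \<nu>" unfolding assms(9) using l assms(6) by (intro divide_pos_pos mult_pos_pos) auto
    ultimately have *: "0 \<le> b" "b \<le> \<nu> / 7"
      using divide_ln_inverse_bounds[of \<nu>] by (auto simp: b_def)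
    have "b * (ln (real n) * ln (real m)) \<le> \<nu> / 7 * (ln (real n) * ln (real m))"
      using * ll by (intro mult_right_mono) auto
    moreover have "\<nu> / 7 * (ln (real n) * ln (real m)) = \<epsilon> / 28" using l by (simp add: assms(9))
    ultimately show ?thesis using * by (simp add: mult_ac)
  qed (use assms(6,9) in \<open>simp add: b_def\<close>)
  have "\<alpha> = 1 + a" "\<beta> = 1 + b" using assms(10,11) by (auto simp: a_def b_def)
  note A = renyi_entropy_bounds[OF \<open>prob_vector x\<close> conjunct1[OF a] M, folded this]
    and B = renyi_entropy_bounds[OF \<open>prob_vector x\<close> conjunct1[OF b] M, folded this]
  have "?H \<le> (1 + \<epsilon>) * renyi_entropy \<alpha> x" and pos: "?H \<noteq> 0 \<Longrightarrow> 0 < renyi_entropy \<alpha> x"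
  proof -
    \<comment> \<open>The constant 56 is twice 28, from the factor \<open>1 / 2\<close> in the
      quadratic bound.\<close>
    have "(1 - \<epsilon> / 56) * ?H \<le> (1 - a * ln (real m) / 2) * ?H"
      using a H by (intro mult_right_mono) auto
    then have le: "(1 - \<epsilon> / 56) * ?H \<le> renyi_entropy \<alpha> x" using A(2) by linarith
    moreover have "0 < (1 - \<epsilon> / 56) * ?H" if "?H \<noteq> 0" using that H assms(7) by simp
    ultimately show "?H \<noteq> 0 \<Longrightarrow> 0 < renyi_entropy \<alpha> x" by linarith
    \<comment> \<open>The excess of \<open>(1 + \<epsilon>) * (1 - \<epsilon> / 56)\<close> over 1
      is \<open>(55 * \<epsilon> - \<epsilon> * \<epsilon>) / 56\<close>.\<close>
    have "\<epsilon> * \<epsilon> \<le> \<epsilon>" using assms(6,7) by (simp add: mult_le_cancel_left2)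
    then have "1 \<le> (1 + \<epsilon>) * (1 - \<epsilon> / 56)" using assms(6) by (simp add: algebra_simps)
    then have "1 * ?H \<le> (1 + \<epsilon>) * (1 - \<epsilon> / 56) * ?H" using H by (intro mult_right_mono)
    also have "\<dots> \<le> (1 + \<epsilon>) * renyi_entropy \<alpha> x"
      unfolding mult.assoc using le assms(6) by (intro mult_left_mono) auto
    finally show "?H \<le> (1 + \<epsilon>) * renyi_entropy \<alpha> x" by simp
  qed
  \<comment> \<open>The two bounds squeeze the entropy of order \<open>\<alpha>\<close> to 0. With
    \<open>pos\<close>, the excluded quotient 0/0 is thus the only way its denominator can
    vanish.\<close>
  moreover have "renyi_entropy \<alpha> x = 0" if "?H = 0" using A that by simp
  ultimately have "\<not> (?H = 0 \<and> renyi_entropy \<alpha> x = 0) \<longrightarrow>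
      1 \<le> ?H / renyi_entropy \<alpha> x \<and> ?H / renyi_entropy \<alpha> x \<le> 1 + \<epsilon>"
    using A(1) by (auto simp: divide_simps)
  moreover have "?H - renyi_entropy \<beta> x \<le> \<epsilon>"
  proof -
    \<comment> \<open>The gap is at most \<open>b * ln (real m) * ?H / 2\<close>. Bounding
      \<open>?H\<close> by \<open>ln (real n)\<close> explains the extra factor
      \<open>ln (real n)\<close> in \<open>\<nu>\<close>.\<close>
    have "0 \<le> b * ln (real m)" using b assms(2,3) by simp
    then have "b * ln (real m) * ?H \<le> b * ln (real m) * ln (real n)"
      using H by (intro mult_left_mono)
    then show ?thesis using B(2) b assms(6) by (simp add: algebra_simps)
  qed
  ultimately show ?thesis using B(1) by simp
qed

end
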